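(* Let $(P_1,\cdot_1,\{~,~\}_1)$ be a Poisson algebra (over a field of characteristic $0$) that acts on another Poisson algebra $(P_2,\cdot_2,\{~,~\}_2)$ by the maps $\mu,\rho:P_1\to\mathrm{End}(P_2)$. A linear map $r:P_2\to P_1$ is a relative Rota-Baxter operator of weight $1$ if and only if the graph $Gr(r)=\{(r(u),u)\mid u\in P_2\}$ is a Poisson subalgebra of $(P_1\oplus P_2,\cdot_\ltimes,\{~,~\}_\ltimes)$.
   Context: A Poisson algebra is a vector space with a commutative associative product and a Lie bracket such that the bracket satisfies the Leibniz rule $\{x,yz\}=\{x,y\}z+y\{x,z\}$; a Poisson subalgebra is a subspace closed under both operations. An action of $(P_1,\cdot_1,\{~,~\}_1)$ on $(P_2,\cdot_2,\{~,~\}_2)$ is given by linear maps $\mu,\rho:P_1\to\mathrm{End}(P_2)$ such that $(P_2,\mu,\rho)$ is a representation of $P_1$ (that is $\mu_{x\cdot_1y}=\mu_x\mu_y$, $\rho_{\{x,y\}_1}=\rho_x\rho_y-\rho_y\rho_x$, $\mu_{\{x,y\}_1}=\rho_x\mu_y-\mu_y\rho_x$, $\rho_{x\cdot_1y}=\mu_x\rho_y+\mu_y\rho_x$) and for all $x\in P_1$, $u,v\in P_2$: $\mu_x(u\cdot_2v)=\mu_x(u)\cdot_2v$, $\mu_x\{u,v\}_2=\{\mu_xu,v\}_2-u\cdot_2\rho_xv$, $\rho_x(u\cdot_2v)=\rho_x(u)\cdot_2v+u\cdot_2\rho_x(v)$, $\rho_x\{u,v\}_2=\{\rho_xu,v\}_2+\{u,\rho_xv\}_2$.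 Then $P_1\oplus P_2$ is a Poisson algebra with $(x,u)\cdot_\ltimes(y,v)=(x\cdot_1y,\ u\cdot_2v+\mu_xv+\mu_yu)$ and $\{(x,u),(y,v)\}_\ltimes=(\{x,y\}_1,\ \{u,v\}_2+\rho_xv-\rho_yu)$. A linear map $r:P_2\to P_1$ is a relative Rota-Baxter operator of weight $1$ if for all $u,v\in P_2$: $r(u)\cdot_1r(v)=r(u\cdot_2v+\mu_{r(u)}v+\mu_{r(v)}u)$ and $\{r(u),r(v)\}_1=r(\{u,v\}_2+\rho_{r(u)}v-\rho_{r(v)}u)$. *)

theory Defs
  imports "HOL-Analysis.Product_Vector"
begin

text \<open>
  Every vector space over the field \<open>'k\<close> is a whole type of class \<^class>\<open>ab_group_add\<close> with an
  explicit scalar multiplication; nothing is assumed about its dimension.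
\<close>

definition bilinear_map ::
  "('k::field \<Rightarrow> 'a::ab_group_add \<Rightarrow> 'a) \<Rightarrow> ('k \<Rightarrow> 'b::ab_group_add \<Rightarrow> 'b) \<Rightarrow>
    ('k \<Rightarrow> 'c::ab_group_add \<Rightarrow> 'c) \<Rightarrow> ('a \<Rightarrow> 'b \<Rightarrow> 'c) \<Rightarrow> bool"
  where "bilinear_map s1 s2 s3 f \<longleftrightarrow>
    (\<forall>x. Vector_Spaces.linear s2 s3 (f x)) \<and> (\<forall>y. Vector_Spaces.linear s1 s3 (\<lambda>x. f x y))"

text \<open>The commutative associative product is not required to have a unit.\<close>

locale poisson_algebra = vector_space scale
  for scale :: "'k::field_char_0 \<Rightarrow> 'a::ab_group_add \<Rightarrow> 'a" +
  fixes mult :: "'a \<Rightarrow> 'a \<Rightarrow> 'a"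
    and bracket :: "'a \<Rightarrow> 'a \<Rightarrow> 'a"
  assumes mult_bilinear: "bilinear_map scale scale scale mult"
    and mult_commute: "mult x y = mult y x"
    and mult_assoc: "mult (mult x y) z = mult x (mult y z)"
    and bracket_bilinear: "bilinear_map scale scale scale bracket"
    and bracket_alternating: "bracket x x = 0"
    and jacobi: "bracket x (bracket y z) + bracket y (bracket z x) + bracket z (bracket x y) = 0"
    and leibniz: "bracket x (mult y z) = mult (bracket x y) z + mult y (bracket x z)"
begin

definition poisson_subalgebra :: "'a set \<Rightarrow> bool"
  where "poisson_subalgebra S \<longleftrightarrow>
    subspace S \<and> (\<forall>x\<in>S. \<forall>y\<in>S. mult x y \<in> S) \<and> (\<forall>x\<in>S. \<forall>y\<in>S. bracket x y \<in> S)"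

end

text \<open>
  A linear map from \<open>'a\<close> to the endomorphisms of \<open>'b\<close> is given in curried form, as a bilinear map
  \<open>'a \<Rightarrow> 'b \<Rightarrow> 'b\<close>.
\<close>

locale poisson_representation = P1: poisson_algebra s1 mult1 br1 + V: vector_space s2
  for s1 :: "'k::field_char_0 \<Rightarrow> 'a::ab_group_add \<Rightarrow> 'a"
    and mult1 br1 :: "'a \<Rightarrow> 'a \<Rightarrow> 'a"
    and s2 :: "'k \<Rightarrow> 'b::ab_group_add \<Rightarrow> 'b" +
  fixes \<mu> \<rho> :: "'a \<Rightarrow> 'b \<Rightarrow> 'b"
  assumes mu_linear: "bilinear_map s1 s2 s2 \<mu>"
    and rho_linear: "bilinear_map s1 s2 s2 \<rho>"
    and mu_mult: "\<mu> (mult1 x y) u = \<mu> x (\<mu> y u)"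
    and rho_bracket: "\<rho> (br1 x y) u = \<rho> x (\<rho> y u) - \<rho> y (\<rho> x u)"
    and mu_bracket: "\<mu> (br1 x y) u = \<rho> x (\<mu> y u) - \<mu> y (\<rho> x u)"
    and rho_mult: "\<rho> (mult1 x y) u = \<mu> x (\<rho> y u) + \<mu> y (\<rho> x u)"

locale poisson_action =
  P1: poisson_algebra s1 mult1 br1 + P2: poisson_algebra s2 mult2 br2 +
  poisson_representation s1 mult1 br1 s2 \<mu> \<rho>
  for s1 :: "'k::field_char_0 \<Rightarrow> 'a::ab_group_add \<Rightarrow> 'a"
    and mult1 br1 :: "'a \<Rightarrow> 'a \<Rightarrow> 'a"
    and s2 :: "'k \<Rightarrow> 'b::ab_group_add \<Rightarrow> 'b"
    and mult2 br2 :: "'b \<Rightarrow> 'b \<Rightarrow> 'b"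
    and \<mu> \<rho> :: "'a \<Rightarrow> 'b \<Rightarrow> 'b" +
  assumes mu_mult2: "\<mu> x (mult2 u v) = mult2 (\<mu> x u) v"
    and mu_br2: "\<mu> x (br2 u v) = br2 (\<mu> x u) v - mult2 u (\<rho> x v)"
    and rho_mult2: "\<rho> x (mult2 u v) = mult2 (\<rho> x u) v + mult2 u (\<rho> x v)"
    and rho_br2: "\<rho> x (br2 u v) = br2 (\<rho> x u) v + br2 u (\<rho> x v)"

definition semidirect_mult ::
  "('a \<Rightarrow> 'a \<Rightarrow> 'a) \<Rightarrow> ('b \<Rightarrow> 'b \<Rightarrow> 'b::ab_group_add) \<Rightarrow> ('a \<Rightarrow> 'b \<Rightarrow> 'b) \<Rightarrow>
    'a \<times> 'b \<Rightarrow> 'a \<times> 'b \<Rightarrow> 'a \<times> 'b"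
  where "semidirect_mult mult1 mult2 \<mu> =
    (\<lambda>(x, u) (y, v). (mult1 x y, mult2 u v + \<mu> x v + \<mu> y u))"

definition semidirect_bracket ::
  "('a \<Rightarrow> 'a \<Rightarrow> 'a) \<Rightarrow> ('b \<Rightarrow> 'b \<Rightarrow> 'b::ab_group_add) \<Rightarrow> ('a \<Rightarrow> 'b \<Rightarrow> 'b) \<Rightarrow>
    'a \<times> 'b \<Rightarrow> 'a \<times> 'b \<Rightarrow> 'a \<times> 'b"
  where "semidirect_bracket br1 br2 \<rho> =
    (\<lambda>(x, u) (y, v). (br1 x y, br2 u v + \<rho> x v - \<rho> y u))"

lemma bilinear_map_simps:
  assumes "bilinear_map s1 s2 s3 f"
  shows "f (x + x') y = f x y + f x' y" "f x (y + y') = f x y + f x y'"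
    "f (x - x') y = f x y - f x' y" "f x (y - y') = f x y - f x y'"
    "f (- x) y = - f x y" "f x (- y) = - f x y"
    "f (s1 c x) y = s3 c (f x y)" "f x (s2 c y) = s3 c (f x y)"
proof -
  interpret l: Vector_Spaces.linear s2 s3 "f x" for x
    using assms by (simp add: bilinear_map_def)
  interpret r: Vector_Spaces.linear s1 s3 "\<lambda>x. f x y" for y
    using assms by (simp add: bilinear_map_def)
  show "f (x + x') y = f x y + f x' y" "f x (y + y') = f x y + f x y'"
    "f (x - x') y = f x y - f x' y" "f x (y - y') = f x y - f x y'"
    "f (- x) y = - f x y" "f x (- y) = - f x y"
    "f (s1 c x) y = s3 c (f x y)" "f x (s2 c y) = s3 c (f x y)"
    by (simp_all add: l.add r.add l.diff r.diff l.neg r.neg l.scale r.scale)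
qed

lemma bilinear_mapI:
  assumes "vector_space s1" "vector_space s2" "vector_space s3"
    and "\<And>x x' y. f (x + x') y = f x y + f x' y" "\<And>x y y'. f x (y + y') = f x y + f x y'"
    and "\<And>c x y. f (s1 c x) y = s3 c (f x y)" "\<And>c x y. f x (s2 c y) = s3 c (f x y)"
  shows "bilinear_map s1 s2 s3 f"
  using assms unfolding bilinear_map_def Vector_Spaces.linear_def module_hom_def
    module_hom_axioms_def module_iff_vector_space by blast

context poisson_algebra
begin

lemma bracket_anti: "bracket x y = - bracket y x"
proof -
  note b = bilinear_map_simps[OF bracket_bilinear]
  have "bracket (x + y) (x + y) = bracket x y + bracket y x"
    by (simp only: b(1,2)) (simp add: bracket_alternating add.commute)
  then have "bracket x y + bracket y x = 0"
    by (simp only: bracket_alternating)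
  then show ?thesis
    by (simp add: eq_neg_iff_add_eq_0)
qed

end

context poisson_action
begin

sublocale prod: vector_space_prod s1 s2
  by unfold_locales

lemma semidirect_poisson_algebra:
  "poisson_algebra (module_prod.scale s1 s2) (semidirect_mult mult1 mult2 \<mu>)
    (semidirect_bracket br1 br2 \<rho>)"
proof -
  note bl = bilinear_map_simps[OF P1.mult_bilinear] bilinear_map_simps[OF P1.bracket_bilinear]
    bilinear_map_simps[OF P2.mult_bilinear] bilinear_map_simps[OF P2.bracket_bilinear]
    bilinear_map_simps[OF mu_linear] bilinear_map_simps[OF rho_linear]
  note d = semidirect_mult_def semidirect_bracket_def
  note sc = prod.scale_prod P1.scale_right_distrib P2.scale_right_distrib
     P1.scale_right_diff_distrib P2.scale_right_diff_distrib
  note ac2 = P2.mult_commute P2.mult_assoc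
  have mu_commute: "\<mu> x (\<mu> y u) = \<mu> y (\<mu> x u)" for x y u
    by (metis mu_mult P1.mult_commute)
  have mult2_mu: "mult2 (\<mu> x u) v = \<mu> x (mult2 u v)" "mult2 u (\<mu> x v) = \<mu> x (mult2 u v)"
    for x u v
    by (metis mu_mult2 P2.mult_commute)+
  have br2_mu: "br2 u (\<mu> x v) = \<mu> x (br2 u v) - mult2 v (\<rho> x u)" for x u v
    using mu_br2[of x v u] P2.bracket_anti[of u] by (simp add: bl)
  have mult2_left_commute: "mult2 u (mult2 v w) = mult2 v (mult2 u w)" for u v w
    by (metis P2.mult_assoc P2.mult_commute)
  have br2_rho: "br2 (\<rho> x u) v = - br2 v (\<rho> x u)" for x u v
    by (rule P2.bracket_anti)
  show ?thesis
  proof (intro poisson_algebra.intro poisson_algebra_axioms.intro bilinear_mapI;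
      (rule prod.p.vector_space_axioms)?)
    fix p q t :: "'a \<times> 'b"
    obtain x u y v z w where [simp]: "p = (x, u)" "q = (y, v)" "t = (z, w)"
      by (metis surj_pair)
    let ?m = "semidirect_mult mult1 mult2 \<mu>"
    let ?b = "semidirect_bracket br1 br2 \<rho>"
    show "?m p q = ?m q p"
      by (simp add: d P1.mult_commute P2.mult_commute algebra_simps)
    show "?m (?m p q) t = ?m p (?m q t)"
      by (simp add: d bl P1.mult_assoc ac2 mult2_left_commute mu_mult mult2_mu mu_commute algebra_simps)
    show "?b p p = 0"
      by (simp add: d P1.bracket_alternating P2.bracket_alternating zero_prod_def)
    show "?b p (?b q t) + ?b q (?b t p) + ?b t (?b p q) = 0"
      using P1.jacobi[of x y z] P2.jacobi[of u v w]
      by (simp add: d bl zero_prod_def rho_br2 br2_rho rho_bracket algebra_simps)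
    show "?b p (?m q t) = ?m (?b p q) t + ?m q (?b p t)"
      by (simp add: d bl P1.leibniz P2.leibniz br2_mu rho_mult rho_mult2 mu_bracket mult2_mu
          P2.mult_commute algebra_simps)
  qed (auto simp: d bl sc)
qed

end

definition relative_rota_baxter ::
  "('k::field \<Rightarrow> 'a::ab_group_add \<Rightarrow> 'a) \<Rightarrow> ('a \<Rightarrow> 'a \<Rightarrow> 'a) \<Rightarrow> ('a \<Rightarrow> 'a \<Rightarrow> 'a) \<Rightarrow>
    ('k \<Rightarrow> 'b::ab_group_add \<Rightarrow> 'b) \<Rightarrow> ('b \<Rightarrow> 'b \<Rightarrow> 'b) \<Rightarrow> ('b \<Rightarrow> 'b \<Rightarrow> 'b) \<Rightarrow>
    ('a \<Rightarrow> 'b \<Rightarrow> 'b) \<Rightarrow> ('a \<Rightarrow> 'b \<Rightarrow> 'b) \<Rightarrow> ('b \<Rightarrow> 'a) \<Rightarrow> bool"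
  where "relative_rota_baxter s1 mult1 br1 s2 mult2 br2 \<mu> \<rho> r \<longleftrightarrow>
    Vector_Spaces.linear s2 s1 r \<and>
    (\<forall>u v. mult1 (r u) (r v) = r (mult2 u v + \<mu> (r u) v + \<mu> (r v) u)) \<and>
    (\<forall>u v. br1 (r u) (r v) = r (br2 u v + \<rho> (r u) v - \<rho> (r v) u))"

end

theory Submission
  imports Defs
begin

text \<open>A pair (x, w) lies in the graph exactly when x = r w. The semidirect product of (r u, u)
  and (r v, v) has first component \<open>mult1 (r u) (r v)\<close> and second component the
  argument of r in the multiplicative Rota-Baxter identity. So closure under the product is that
  identity, and closure under the bracket is likewise the other one. Linearity of r makes the graph
  a subspace.\<close>

theorem proposition5p15:
  fixes s1 :: "'k::field_char_0 \<Rightarrow> 'a::ab_group_add \<Rightarrow> 'a"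
    and mult1 br1 :: "'a \<Rightarrow> 'a \<Rightarrow> 'a"
    and s2 :: "'k \<Rightarrow> 'b::ab_group_add \<Rightarrow> 'b"
    and mult2 br2 :: "'b \<Rightarrow> 'b \<Rightarrow> 'b"
    and \<mu> \<rho> :: "'a \<Rightarrow> 'b \<Rightarrow> 'b"
    and r :: "'b \<Rightarrow> 'a"
  assumes "poisson_algebra s1 mult1 br1"
    and "poisson_algebra s2 mult2 br2"
    and "poisson_action s1 mult1 br1 s2 mult2 br2 \<mu> \<rho>"
    and "Vector_Spaces.linear s2 s1 r"
  shows "relative_rota_baxter s1 mult1 br1 s2 mult2 br2 \<mu> \<rho> r \<longleftrightarrow>
    poisson_algebra.poisson_subalgebra (module_prod.scale s1 s2)
      (semidirect_mult mult1 mult2 \<mu>) (semidirect_bracket br1 br2 \<rho>)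
      {(r u, u) | u. True}"
proof -
  interpret A: poisson_action s1 mult1 br1 s2 mult2 br2 \<mu> \<rho>
    by fact
  interpret r: Vector_Spaces.linear s2 s1 r
    by fact
  \<comment> \<open>The defining equation of \<open>poisson_subalgebra\<close> carries the locale
    hypothesis, so it can be unfolded only once the semidirect product is known to be a Poisson
    algebra.\<close>
  interpret S: poisson_algebra "module_prod.scale s1 s2" "semidirect_mult mult1 mult2 \<mu>"
    "semidirect_bracket br1 br2 \<rho>"
    by (rule A.semidirect_poisson_algebra)
  have "A.prod.p.subspace {(r u, u) | u. True}"
    by (auto simp: A.prod.p.subspace_def zero_prod_def A.prod.scale_prod r.zero r.add r.scale)
  \<comment> \<open>Linearity and the subspace condition are settled, so only the two closure
    conditions remain to be matched with the two identities, for all u and v.\<close>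
  then show ?thesis
    using assms(4) unfolding S.poisson_subalgebra_def relative_rota_baxter_def
    by (auto simp: semidirect_mult_def semidirect_bracket_def)
qed

end
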